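(* Let $n, d$ be positive integers with $d = O(1)$ with respect to $n$, and let $p \in \mathbb{R}^{(n+1)\times d}$. Then, for each $t$ with $0 \le t \le 1$, the vector $\gamma(t) = e_{n+1}^\top \mathcal{B}_n^{(t)} p \in \mathbb{R}^d$ can be computed in $O(d\, n \log n)$ time (with an implied constant independent of $n$, $d$, $t$ and $p$).
   Context: For $0 \le t \le 1$ and $0 \le j \le i$, the $j$th Bernstein polynomial of degree $i$ is $b_j^{(i)}(t) = \binom{i}{j} t^j (1-t)^{i-j}$. The $n$th Bernstein matrix $\mathcal{B}_n^{(t)} \in \mathbb{R}^{(n+1)\times(n+1)}$ is the lower triangular matrix (rows and columns indexed by $0,\ldots,n$) with entries $(\mathcal{B}_n^{(t)})_{ij} = b_j^{(i)}(t)$ for $j \le i$ and $0$ for $j>i$. Here $e_{n+1} \in \mathbb{R}^{n+1}$ is the last standard basis vector, so $\gamma(t)$ is the last row of $\mathcal{B}_n^{(t)} p$; it is the point at parameter $t$ of the Bézier curve $\gamma : [0,1] \to \mathbb{R}^d$ whose $n+1$ control points are the rows of $p$. Time is measured as the number of exact arithmetic operations on real or complex numbers (with the roots of unity used by the fast Fourier transform available), so that discrete Fourier transforms and convolutions of length $O(n)$ can be computed in $O(n\log n)$ time. *)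

theory Defs
  imports "HOL-Analysis.Weierstrass_Theorems" "Jordan_Normal_Form.Matrix"
begin

section \<open>Bernstein matrices and Bezier curves\<close>

text \<open>\<open>Bernstein i j t\<close> is the library's $j$th Bernstein polynomial of degree $i$.\<close>

definition bernstein_mat :: "nat \<Rightarrow> real \<Rightarrow> real mat" where
  "bernstein_mat n t =
     mat (n + 1) (n + 1) (\<lambda>(i, j). if j \<le> i then Bernstein i j t else 0)"

text \<open>Indices are 0-based, so the last standard basis vector of dimension \<open>n + 1\<close> is
  \<open>unit_vec (n + 1) n\<close>.\<close>

definition bezier_point :: "nat \<Rightarrow> real \<Rightarrow> real mat \<Rightarrow> real Matrix.vec" where
  "bezier_point n t p = row (mat_of_row (unit_vec (n + 1) n) * bernstein_mat n t * p) 0"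

section \<open>A random access machine with exact complex arithmetic\<close>

text \<open>
  The machine has natural-number registers, which hold sizes, loop counters and addresses,
  and an infinite complex memory, which is addressed indirectly: an operand \<open>a\<close> of a complex
  instruction denotes the memory cell whose address is the content of register \<open>a\<close>.
  Complex data arise only from the input, from integer literals of the program, from the four
  arithmetic operations and from roots of unity; no register content can be converted into a
  complex number otherwise. Programs are finite objects that do not depend on the input, so a
  program is a uniform algorithm for inputs of all sizes.
\<close>

type_synonym reg = nat
type_synonym state = "(reg \<Rightarrow> nat) \<times> (nat \<Rightarrow> complex)"

datatype arith = Add | Sub | Mul | Div

datatype instr =
    RConst reg nat
  | RArith arith reg reg reg
  | CConst reg int
  | CMove reg reg
  | CArith arith reg reg reg
  | CRoot reg reg reg

text \<open>Subtraction of register contents is truncated and their division is integer division.\<close>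

fun nat_arith :: "arith \<Rightarrow> nat \<Rightarrow> nat \<Rightarrow> nat option" where
  "nat_arith Add x y = Some (x + y)"
| "nat_arith Sub x y = Some (x - y)"
| "nat_arith Mul x y = Some (x * y)"
| "nat_arith Div x y = (if y = 0 then None else Some (x div y))"

fun complex_arith :: "arith \<Rightarrow> complex \<Rightarrow> complex \<Rightarrow> complex option" where
  "complex_arith Add x y = Some (x + y)"
| "complex_arith Sub x y = Some (x - y)"
| "complex_arith Mul x y = Some (x * y)"
| "complex_arith Div x y = (if y = 0 then None else Some (x / y))"

text \<open>\<open>None\<close> means that the machine is stuck (division by zero or a root of unity of order 0).
  \<open>CRoot a j m\<close> provides the root of unity $e^{2 \pi i J / M}$, where $J$ and $M$ are the
  contents of the registers \<open>j\<close> and \<open>m\<close>.\<close>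

fun step :: "instr \<Rightarrow> state \<Rightarrow> state option" where
  "step (RConst x k) (R, M) = Some (R(x := k), M)"
| "step (RArith f x y z) (R, M) =
     map_option (\<lambda>v. (R(x := v), M)) (nat_arith f (R y) (R z))"
| "step (CConst a k) (R, M) = Some (R, M(R a := of_int k))"
| "step (CMove a b) (R, M) = Some (R, M(R a := M (R b)))"
| "step (CArith f a b c) (R, M) =
     map_option (\<lambda>v. (R, M(R a := v))) (complex_arith f (M (R b)) (M (R c)))"
| "step (CRoot a j m) (R, M) =
     (if R m = 0 then None
      else Some (R, M(R a := cis (2 * pi * real (R j) / real (R m)))))"

datatype test = RLess reg reg | CIsZero reg

fun holds :: "test \<Rightarrow> state \<Rightarrow> bool" where
  "holds (RLess x y) (R, M) = (R x < R y)"
| "holds (CIsZero a) (R, M) = (M (R a) = 0)"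

datatype prog =
    Skip
  | Instr instr
  | Seq prog prog
  | If test prog prog
  | While test prog

text \<open>\<open>exec c s k s'\<close>: started in state \<open>s\<close>, program \<open>c\<close> terminates in state \<open>s'\<close> after \<open>k\<close>
  time units. Every executed instruction and every evaluated test takes one unit. So the time
  counts all arithmetic operations on complex numbers and, in addition, all the bookkeeping
  on registers; in particular, it bounds the number of arithmetic operations from above.\<close>

inductive exec :: "prog \<Rightarrow> state \<Rightarrow> nat \<Rightarrow> state \<Rightarrow> bool" where
  Skip: "exec Skip s 0 s"
| Instr: "step i s = Some s' \<Longrightarrow> exec (Instr i) s 1 s'"
| Seq: "exec c1 s k1 s' \<Longrightarrow> exec c2 s' k2 s'' \<Longrightarrow> exec (Seq c1 c2) s (k1 + k2) s''"
| IfTrue: "holds b s \<Longrightarrow> exec c1 s k s' \<Longrightarrow> exec (If b c1 c2) s (1 + k) s'"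
| IfFalse: "\<not> holds b s \<Longrightarrow> exec c2 s k s' \<Longrightarrow> exec (If b c1 c2) s (1 + k) s'"
| WhileFalse: "\<not> holds b s \<Longrightarrow> exec (While b c) s 1 s"
| WhileTrue: "holds b s \<Longrightarrow> exec c s k1 s' \<Longrightarrow> exec (While b c) s' k2 s'' \<Longrightarrow>
    exec (While b c) s (1 + k1 + k2) s''"

lemma exec_deterministic:
  assumes "exec c s k s'" and "exec c s k' s''"
  shows "k' = k \<and> s'' = s'"
  using assms
proof (induction arbitrary: k' s'' rule: exec.induct)
  case (Skip s)
  from Skip.prems show ?case by cases simp
next
  case (Instr i s s')
  from Instr.prems Instr.hyps show ?case by cases simp
next
  case (Seq c1 s k1 s1 c2 k2 s2)
  from Seq.prems show ?case
  proof cases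
    case (Seq l1 u l2)
    with Seq.IH(1)[of l1 u] Seq.IH(2)[of l2 s''] show ?thesis by simp
  qed
next
  case (IfTrue b s c1 k s1 c2)
  from IfTrue.prems IfTrue.hyps show ?case by cases (simp_all add: IfTrue.IH)
next
  case (IfFalse b s c2 k s1 c1)
  from IfFalse.prems IfFalse.hyps show ?case by cases (simp_all add: IfFalse.IH)
next
  case (WhileFalse b s c)
  from WhileFalse.prems WhileFalse.hyps show ?case by cases simp_all
next
  case (WhileTrue b s c k1 s1 k2 s2)
  from WhileTrue.prems show ?case
  proof cases
    case WhileFalse
    with WhileTrue.hyps show ?thesis by simp
  next
    case (WhileTrue l1 u l2)
    with WhileTrue.IH(1)[of l1 u] WhileTrue.IH(2)[of l2 s''] show ?thesis by simp
  qed
qed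

section \<open>Input and output format\<close>

text \<open>Registers 0 and 1 hold \<open>n\<close> and \<open>d\<close>. Memory cell 0 holds \<open>t\<close>, and the cells
  \<open>1, \<dots>, (n + 1) * d\<close> hold the entries of \<open>p\<close> row by row. Everything else is 0.\<close>

definition bezier_input :: "nat \<Rightarrow> nat \<Rightarrow> real \<Rightarrow> real mat \<Rightarrow> state" where
  "bezier_input n d t p =
     ((\<lambda>x. if x = 0 then n else if x = 1 then d else 0),
      (\<lambda>a. if a = 0 then of_real t
           else if a \<le> (n + 1) * d then of_real (p $$ ((a - 1) div d, (a - 1) mod d))
           else 0))"

text \<open>The result is read off the \<open>d\<close> cells that follow the input.\<close>

definition bezier_output :: "nat \<Rightarrow> nat \<Rightarrow> state \<Rightarrow> complex Matrix.vec" where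
  "bezier_output n d s = Matrix.vec d (\<lambda>k. snd s ((n + 1) * d + 1 + k))"

end

theory Submission
  imports Defs
begin

text \<open>
  A single point needs only the last row of the Bernstein matrix, so no fast Fourier transform is
  required: the Horner-like scheme $a \leftarrow a (1 - t) + {n \choose j} t^j p_j$ for
  $j = 0, \dots, n$ ends with $a = \gamma(t)$, and the weights satisfy
  ${n \choose j+1} t^{j+1} = {n \choose j} t^j \cdot t (n - j) / (j + 1)$. The scheme never divides
  by $t$ or $1 - t$ and takes $O(d n)$ operations. The number $n$ is not available as a complex
  number and is obtained there by counting.
\<close>

section \<open>Timed Hoare triples\<close>

text \<open>Total correctness with the exact running time \<open>k\<close> rather than a bound, so
  times simply add up under composition.\<close>

definition triple :: "(state \<Rightarrow> bool) \<Rightarrow> prog \<Rightarrow> nat \<Rightarrow> (state \<Rightarrow> bool) \<Rightarrow> bool" where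
  "triple P c k Q \<longleftrightarrow> (\<forall>s. P s \<longrightarrow> (\<exists>s'. exec c s k s' \<and> Q s'))"

lemma triple_Seq:
  assumes "triple P c k Q" and "triple Q c' k' Q'"
  shows "triple P (Seq c c') (k + k') Q'"
  using assms unfolding triple_def by (meson exec.Seq)

lemma triple_While:
  assumes body: "\<And>i. i < N \<Longrightarrow> triple (I i) c k (I (Suc i))"
    and continue: "\<And>i s. i < N \<Longrightarrow> I i s \<Longrightarrow> holds b s"
    and stop: "\<And>s. I N s \<Longrightarrow> \<not> holds b s"
  shows "triple (I 0) (While b c) (N * (k + 1) + 1) (I N)"
proof -
  \<comment> \<open>Induction on the number \<open>m\<close> of remaining iterations:
    \<open>WhileTrue\<close> peels off the first iteration while the index of \<open>I\<close>
    counts upwards. Each pass costs \<open>k\<close> plus one test.\<close>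
  have "\<exists>s'. exec (While b c) s (m * (k + 1) + 1) s' \<and> I N s'"
    if "I (N - m) s" and "m \<le> N" for m s
    using that
  proof (induction m arbitrary: s)
    case 0
    then have "exec (While b c) s 1 s" using stop exec.WhileFalse by simp
    moreover have "I N s" using 0 by simp
    ultimately show ?case by (metis add_0 mult_0)
  next
    case (Suc m)
    then have less: "N - Suc m < N" and next_index: "Suc (N - Suc m) = N - m" by auto
    obtain s1 where s1: "exec c s k s1" "I (N - m) s1"
      using body[OF less] Suc.prems(1) unfolding triple_def next_index by blast
    obtain s' where s': "exec (While b c) s1 (m * (k + 1) + 1) s'" "I N s'"
      using Suc.IH[OF s1(2)] Suc.prems(2) by auto
    have "exec (While b c) s (1 + k + (m * (k + 1) + 1)) s'"
      using exec.WhileTrue[OF continue[OF less Suc.prems(1)] s1(1) s'(1)] .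
    moreover have "1 + k + (m * (k + 1) + 1) = Suc m * (k + 1) + 1" by simp
    ultimately show ?case using s'(2) by metis
  qed
  from this[of N] show ?thesis unfolding triple_def by simp
qed

fun block :: "instr list \<Rightarrow> prog" where
  "block [] = Skip"
| "block (i # is) = Seq (Instr i) (block is)"

text \<open>A functional semantics for straight-line code, which the simplifier can run
  symbolically; the closing \<open>Skip\<close> of \<open>block\<close> is free, so the time is the
  length of the list.\<close>

fun steps :: "instr list \<Rightarrow> state \<Rightarrow> state option" where
  "steps [] s = Some s"
| "steps (i # is) s = Option.bind (step i s) (steps is)"

lemma exec_block: "steps is s = Some s' \<Longrightarrow> exec (block is) s (length is) s'"
proof (induction "is" arbitrary: s)
  case Nil
  then show ?case by (auto intro: exec.Skip)
next
  case (Cons i "is")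
  then obtain s1 where "step i s = Some s1" "steps is s1 = Some s'"
    by (auto simp: bind_eq_Some_conv)
  then have "exec (block (i # is)) s (1 + length is) s'"
    unfolding block.simps using Cons.IH by (intro exec.Seq exec.Instr)
  then show ?case by simp
qed

lemma triple_block:
  assumes "\<And>R M. P (R, M) \<Longrightarrow> \<exists>s'. steps is (R, M) = Some s' \<and> Q s'"
    and "k = length is"
  shows "triple P (block is) k Q"
  using assms exec_block unfolding triple_def by (metis surj_pair)

section \<open>The Bernstein--Horner scheme\<close>

text \<open>The Bernstein polynomial without its power of \<open>1 - t\<close>, which the repeated
  multiplication in \<open>horner\<close> supplies.\<close>

definition weight :: "nat \<Rightarrow> real \<Rightarrow> nat \<Rightarrow> real" where
  "weight n t j = real (n choose j) * t ^ j"

lemma weight_0: "weight n t 0 = 1"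
  by (simp add: weight_def)

text \<open>Both \<open>Suc j * (n choose Suc j)\<close> and \<open>(n - j) * (n choose j)\<close>
  equal \<open>n * ((n - 1) choose j)\<close>. For \<open>j = n\<close> both sides vanish.\<close>

lemma weight_Suc:
  assumes "j \<le> n"
  shows "weight n t (Suc j) = weight n t j * t * (real n - real j) / (real j + 1)"
proof -
  have "Suc j * (n choose Suc j) = (n - j) * (n choose j)"
    by (metis binomial_absorption binomial_absorb_comp)
  then have "real (Suc j) * real (n choose Suc j) = real (n - j) * real (n choose j)"
    by (metis of_nat_mult)
  then have "real (n choose Suc j) = (real n - real j) * real (n choose j) / (real j + 1)"
    using assms by (simp add: field_simps of_nat_diff)
  then show ?thesis by (simp add: weight_def)
qed

fun horner :: "nat \<Rightarrow> real \<Rightarrow> real mat \<Rightarrow> nat \<Rightarrow> nat \<Rightarrow> real" where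
  "horner n t p 0 m = 0"
| "horner n t p (Suc j) m = horner n t p j m * (1 - t) + weight n t j * p $$ (j, m)"

text \<open>Row \<open>i\<close> enters at step \<open>i + 1\<close> and is multiplied by
  \<open>1 - t\<close> in each of the \<open>j - i\<close> later steps.\<close>

lemma horner_eq_sum:
  "horner n t p (Suc j) m = (\<Sum>i\<le>j. weight n t i * (1 - t) ^ (j - i) * p $$ (i, m))"
proof (induction j)
  case 0
  show ?case by simp
next
  case (Suc j)
  have "horner n t p (Suc (Suc j)) m =
      (\<Sum>i\<le>j. weight n t i * (1 - t) ^ (j - i) * p $$ (i, m)) * (1 - t)
      + weight n t (Suc j) * p $$ (Suc j, m)"
    using Suc.IH by simp
  also have "(\<Sum>i\<le>j. weight n t i * (1 - t) ^ (j - i) * p $$ (i, m)) * (1 - t) =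
      (\<Sum>i\<le>j. weight n t i * (1 - t) ^ (Suc j - i) * p $$ (i, m))"
    unfolding sum_distrib_right by (rule sum.cong) (auto simp: Suc_diff_le)
  finally show ?case by simp
qed

lemma bezier_point_eq_horner:
  assumes "p \<in> carrier_mat (n + 1) d" and "m < d"
  shows "bezier_point n t p $ m = horner n t p (n + 1) m"
proof -
  let ?e = "unit_vec (n + 1) n :: real Matrix.vec"
  have "row (mat_of_row ?e * bernstein_mat n t) 0 = row (bernstein_mat n t) n"
  proof (rule eq_vecI)
    fix i assume "i < dim_vec (row (bernstein_mat n t) n)"
    then have i: "i < n + 1" by (simp add: bernstein_mat_def)
    have "row (mat_of_row ?e * bernstein_mat n t) 0 $ i = ?e \<bullet> col (bernstein_mat n t) i"
      using i by (simp add: bernstein_mat_def)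
    also have "\<dots> = col (bernstein_mat n t) i $ n"
      by (rule scalar_prod_left_unit) (auto simp: bernstein_mat_def col_def)
    finally show "row (mat_of_row ?e * bernstein_mat n t) 0 $ i = row (bernstein_mat n t) n $ i"
      using i by (simp add: bernstein_mat_def)
  qed (simp add: bernstein_mat_def)
  then have "bezier_point n t p $ m = row (bernstein_mat n t) n \<bullet> col p m"
    using assms by (simp add: bezier_point_def)
  also have "\<dots> = (\<Sum>i = 0..<n + 1. Bernstein n i t * p $$ (i, m))"
    using assms by (auto simp: scalar_prod_def bernstein_mat_def intro!: sum.cong)
  also have "\<dots> = (\<Sum>i\<le>n. weight n t i * (1 - t) ^ (n - i) * p $$ (i, m))"
    by (rule sum.cong) (auto simp: Bernstein_def weight_def)
  also have "\<dots> = horner n t p (n + 1) m"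
    using horner_eq_sum[of n t p n m] by simp
  finally show ?thesis .
qed

section \<open>The program\<close>

text \<open>
  Write $B = (n+1) d + 1$ for the address of the first output cell. Registers 5 to 10 point to the
  scratch cells $B + d, \dots, B + d + 5$, which hold $1 - t$, the weight, $j + 1$, $n - j$,
  a temporary value and $1$; register 15 is never written and points to \<open>t\<close>.
  Registers 11 and 12 are loop counters, register 13 points to the current entry of \<open>p\<close> and
  register 14 to the current output cell.
\<close>

definition init_code :: "instr list" where
  "init_code =
    [RConst 2 1, RArith Add 3 0 2, RArith Mul 4 3 1, RArith Add 4 4 2,
     RArith Add 5 4 1, RArith Add 6 5 2, RArith Add 7 6 2, RArith Add 8 7 2,
     RArith Add 9 8 2, RArith Add 10 9 2, RConst 13 1,
     CConst 10 1, CArith Sub 5 10 15, CConst 6 1, CConst 7 1]"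

definition count_code :: "instr list" where
  "count_code = [CArith Add 8 8 10, RArith Add 11 11 2]"

text \<open>Register 13 is never reset between rows: \<open>p\<close> is stored row by row, so it
  just keeps advancing.\<close>

definition inner_code :: "instr list" where
  "inner_code =
    [CArith Mul 9 6 13, CArith Mul 14 14 5, CArith Add 14 14 9,
     RArith Add 12 12 2, RArith Add 13 13 2, RArith Add 14 14 2]"

definition weight_code :: "instr list" where
  "weight_code =
    [CArith Mul 6 6 15, CArith Mul 6 6 8, CArith Div 6 6 7,
     CArith Add 7 7 10, CArith Sub 8 8 10, RArith Add 11 11 2]"

definition row_code :: prog where
  "row_code =
    Seq (block [RConst 12 0, RArith Add 14 4 12])
   (Seq (While (RLess 12 1) (block inner_code)) (block weight_code))"

definition bezier_code :: prog where
  "bezier_code =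
    Seq (block init_code)
   (Seq (While (RLess 11 0) (block count_code))
   (Seq (block [RConst 11 0]) (While (RLess 11 3) row_code)))"

section \<open>Memory layout and loop invariants\<close>

definition out :: "nat \<Rightarrow> nat \<Rightarrow> nat" where
  "out n d = (n + 1) * d + 1"

text \<open>Collects what every loop leaves unchanged.\<close>

definition layout :: "nat \<Rightarrow> nat \<Rightarrow> real \<Rightarrow> real mat \<Rightarrow> state \<Rightarrow> bool" where
  "layout n d t p = (\<lambda>(R, M). let B = out n d in
     R 0 = n \<and> R 1 = d \<and> R 2 = 1 \<and> R 3 = n + 1 \<and> R 4 = B \<and> R 5 = B + d \<and> R 6 = B + d + 1 \<and>
     R 7 = B + d + 2 \<and> R 8 = B + d + 3 \<and> R 9 = B + d + 4 \<and> R 10 = B + d + 5 \<and> R 15 = 0 \<and>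
     M 0 = of_real t \<and>
     (\<forall>a. 0 < a \<and> a < B \<longrightarrow> M a = of_real (p $$ ((a - 1) div d, (a - 1) mod d))) \<and>
     M (B + d) = of_real (1 - t) \<and> M (B + d + 5) = 1)"

definition count_inv :: "nat \<Rightarrow> nat \<Rightarrow> real \<Rightarrow> real mat \<Rightarrow> nat \<Rightarrow> state \<Rightarrow> bool" where
  "count_inv n d t p i = (\<lambda>(R, M). let B = out n d in
     layout n d t p (R, M) \<and> R 11 = i \<and> R 13 = 1 \<and>
     M (B + d + 1) = 1 \<and> M (B + d + 2) = 1 \<and> M (B + d + 3) = of_nat i \<and>
     (\<forall>m<d. M (B + m) = 0))"

text \<open>Rows below \<open>j\<close> are done, and so are the first \<open>k\<close> columns of
  row \<open>j\<close>; hence the case split in the accumulators. The weight still belongs to row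
  \<open>j\<close> even when \<open>k = d\<close>.\<close>

definition row_inv :: "nat \<Rightarrow> nat \<Rightarrow> real \<Rightarrow> real mat \<Rightarrow> nat \<Rightarrow> nat \<Rightarrow> state \<Rightarrow> bool" where
  "row_inv n d t p j k = (\<lambda>(R, M). let B = out n d in
     layout n d t p (R, M) \<and> R 11 = j \<and> R 13 = 1 + j * d + k \<and>
     M (B + d + 1) = of_real (weight n t j) \<and> M (B + d + 2) = of_nat j + 1 \<and>
     M (B + d + 3) = of_nat n - of_nat j \<and>
     (\<forall>m<d. M (B + m) = of_real (horner n t p (if m < k then j + 1 else j) m)))"

definition inner_inv :: "nat \<Rightarrow> nat \<Rightarrow> real \<Rightarrow> real mat \<Rightarrow> nat \<Rightarrow> nat \<Rightarrow> state \<Rightarrow> bool" where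
  "inner_inv n d t p j k = (\<lambda>(R, M).
     row_inv n d t p j k (R, M) \<and> R 12 = k \<and> R 14 = out n d + k)"

text \<open>Ensures that entries of \<open>p\<close> are read from input cells, which lie below all
  cells that are written.\<close>

lemma entry_address_less:
  assumes "j \<le> n" and "m < d"
  shows "1 + j * d + m < out n d"
proof -
  have "j * d \<le> n * d" using assms(1) by simp
  then have "j * d + m < n * d + d" using assms(2) by linarith
  then show ?thesis by (simp add: out_def)
qed

lemma out_pos: "0 < out n d"
  by (simp add: out_def)

section \<open>Correctness and cost of the program parts\<close>

lemma triple_init:
  "triple (\<lambda>s. s = bezier_input n d t p) (block init_code) 15 (count_inv n d t p 0)"
proof (rule triple_block)
  fix R M assume "(R, M) = bezier_input n d t p"
  moreover have "out n d = Suc (d + n * d)" by (simp add: out_def)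
  ultimately show "\<exists>s'. steps init_code (R, M) = Some s' \<and> count_inv n d t p 0 s'"
    by (auto simp: init_code_def bezier_input_def count_inv_def layout_def Let_def)
qed (simp add: init_code_def)

lemma triple_count: "triple (count_inv n d t p i) (block count_code) 2 (count_inv n d t p (Suc i))"
proof (rule triple_block)
  fix R M assume "count_inv n d t p i (R, M)"
  then show "\<exists>s'. steps count_code (R, M) = Some s' \<and> count_inv n d t p (Suc i) s'"
    using out_pos[of n d]
    by (auto simp: count_code_def count_inv_def layout_def Let_def)
qed (simp add: count_code_def)

lemma triple_inner:
  assumes "j \<le> n" and "k < d"
  shows "triple (inner_inv n d t p j k) (block inner_code) 6 (inner_inv n d t p j (Suc k))"
proof (rule triple_block)
  fix R M assume "inner_inv n d t p j k (R, M)"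
  moreover have "Suc (j * d + k) < out n d" using entry_address_less[OF assms] by simp
  \<comment> \<open>Decodes the cell under register 13 as the entry of \<open>p\<close> in row
    \<open>j\<close> and column \<open>k\<close>.\<close>
  moreover have "(j * d + k) div d = j" "(j * d + k) mod d = k" using assms(2) by auto
  ultimately show "\<exists>s'. steps inner_code (R, M) = Some s' \<and> inner_inv n d t p j (Suc k) s'"
    using assms(2) out_pos[of n d]
    by (auto simp: inner_code_def inner_inv_def row_inv_def layout_def Let_def less_Suc_eq)
qed (simp add: inner_code_def)

lemma triple_row_start:
  "triple (row_inv n d t p j 0) (block [RConst 12 0, RArith Add 14 4 12]) 2 (inner_inv n d t p j 0)"
  by (rule triple_block) (auto simp: inner_inv_def row_inv_def layout_def Let_def)

text \<open>The case \<open>j = n\<close> needs no special treatment: the weight becomes 0 and the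
  complex counter \<open>n - j\<close> becomes -1 without truncation.\<close>

lemma triple_weight:
  assumes "j \<le> n"
  shows "triple (inner_inv n d t p j d) (block weight_code) 6 (row_inv n d t p (Suc j) 0)"
proof (rule triple_block)
  fix R M assume "inner_inv n d t p j d (R, M)"
  moreover have "complex_of_nat j + 1 \<noteq> 0"
    by (metis of_nat_Suc of_nat_eq_0_iff add.commute nat.distinct(1))
  ultimately show "\<exists>s'. steps weight_code (R, M) = Some s' \<and> row_inv n d t p (Suc j) 0 s'"
    using assms out_pos[of n d]
    by (auto simp: weight_code_def inner_inv_def row_inv_def layout_def Let_def weight_Suc)
qed (simp add: weight_code_def)

text \<open>Each column costs 6 instructions and a test; the constant 9 is 2 for the setup, 1 for
  the failing test and 6 for the weight update.\<close>

lemma triple_row: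
  assumes "j \<le> n"
  shows "triple (row_inv n d t p j 0) row_code (7 * d + 9) (row_inv n d t p (Suc j) 0)"
proof -
  have "triple (inner_inv n d t p j 0) (While (RLess 12 1) (block inner_code)) (d * (6 + 1) + 1)
      (inner_inv n d t p j d)"
    by (rule triple_While)
      (use assms triple_inner in \<open>auto simp: inner_inv_def row_inv_def layout_def Let_def\<close>)
  from triple_Seq[OF triple_row_start triple_Seq[OF this triple_weight[OF assms]]]
  have "triple (row_inv n d t p j 0) row_code (2 + (d * (6 + 1) + 1 + 6))
      (row_inv n d t p (Suc j) 0)"
    by (simp only: row_code_def)
  moreover have "2 + (d * (6 + 1) + 1 + 6) = 7 * d + 9" by simp
  ultimately show ?thesis by metis
qed

lemma triple_bezier:
  "triple (\<lambda>s. s = bezier_input n d t p) bezier_code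
     (15 + (n * (2 + 1) + 1 + (1 + ((n + 1) * (7 * d + 9 + 1) + 1)))) (row_inv n d t p (n + 1) 0)"
proof -
  have count: "triple (count_inv n d t p 0) (While (RLess 11 0) (block count_code))
      (n * (2 + 1) + 1) (count_inv n d t p n)"
    by (rule triple_While)
      (use triple_count in \<open>auto simp: count_inv_def layout_def Let_def\<close>)
  have reset: "triple (count_inv n d t p n) (block [RConst 11 0]) 1 (row_inv n d t p 0 0)"
    by (rule triple_block)
      (auto simp: count_inv_def row_inv_def layout_def Let_def weight_0)
  have rows: "triple (row_inv n d t p 0 0) (While (RLess 11 3) row_code)
      ((n + 1) * (7 * d + 9 + 1) + 1) (row_inv n d t p (n + 1) 0)"
    \<comment> \<open>The explicit instance tells unification which of the two zeros in
      \<open>row_inv n d t p 0 0\<close> is the loop index.\<close>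
    by (rule triple_While[where I = "\<lambda>j. row_inv n d t p j 0"])
      (use triple_row in \<open>auto simp: row_inv_def layout_def Let_def\<close>)
  show ?thesis
    unfolding bezier_code_def
    by (rule triple_Seq[OF triple_init triple_Seq[OF count triple_Seq[OF reset rows]]])
qed

theorem mainTheorem5:
  shows "\<exists>(c :: prog) (C :: real). \<forall>(n :: nat) (d :: nat) (p :: real mat) (t :: real).
    n > 0 \<longrightarrow> d > 0 \<longrightarrow> p \<in> carrier_mat (n + 1) d \<longrightarrow> 0 \<le> t \<longrightarrow> t \<le> 1 \<longrightarrow>
    (\<exists>k s. exec c (bezier_input n d t p) k s \<and>
       bezier_output n d s = map_vec of_real (bezier_point n t p) \<and>
       real k \<le> C * (real d * real n * max 1 (log 2 (real n))))"
proof (rule exI, rule exI, intro allI impI)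
  fix n d :: nat and p :: "real mat" and t :: real
  assume n: "n > 0" and d: "d > 0" and p: "p \<in> carrier_mat (n + 1) d"
  define k where "k = 15 + (n * (2 + 1) + 1 + (1 + ((n + 1) * (7 * d + 9 + 1) + 1)))"
  obtain s where s: "exec bezier_code (bezier_input n d t p) k s" "row_inv n d t p (n + 1) 0 s"
    using triple_bezier unfolding triple_def k_def by blast
  have "bezier_output n d s = map_vec of_real (bezier_point n t p)"
  proof (rule eq_vecI)
    fix m assume "m < dim_vec (map_vec complex_of_real (bezier_point n t p))"
    then have m: "m < d" using p by (simp add: bezier_point_def)
    then have "snd s ((n + 1) * d + 1 + m) = of_real (horner n t p (n + 1) m)"
      using s(2) by (cases s) (simp add: row_inv_def Let_def out_def)
    then show "bezier_output n d s $ m = map_vec of_real (bezier_point n t p) $ m"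
      using m p bezier_point_eq_horner[OF p m]
      by (simp add: bezier_output_def bezier_point_def)
  qed (use p in \<open>simp add: bezier_output_def bezier_point_def\<close>)
  moreover have "real k \<le> 55 * (real d * real n * max 1 (log 2 (real n)))"
  proof -
    \<comment> \<open>Each monomial of \<open>k\<close> is at most a multiple of
      \<open>n * d\<close>, and 55 = 7 + 13 + 7 + 28.\<close>
    have "1 \<le> n * d" "n \<le> n * d" "d \<le> n * d" using n d by auto
    moreover have "k = 7 * (n * d) + 13 * n + 7 * d + 28" by (simp add: k_def algebra_simps)
    ultimately have "k \<le> 55 * (n * d)" by linarith
    then have "k \<le> 55 * (d * n)" by (simp add: mult.commute)
    then have "real k \<le> 55 * (real d * real n)" by (metis of_nat_le_iff of_nat_mult of_nat_numeral)
    \<comment> \<open>The linear bound suffices because the last factor is at least 1.\<close>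
    also have "\<dots> \<le> 55 * (real d * real n * max 1 (log 2 (real n)))"
      using mult_left_mono[of 1 "max 1 (log 2 (real n))" "real d * real n"] by simp
    finally show ?thesis .
  qed
  ultimately show "\<exists>k s. exec bezier_code (bezier_input n d t p) k s \<and>
      bezier_output n d s = map_vec of_real (bezier_point n t p) \<and>
      real k \<le> 55 * (real d * real n * max 1 (log 2 (real n)))"
    using s(1) by blast
qed

end
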